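(* Let $d\ge 2$ and let $\mathcal I$ and $\mathcal J$ be integer $(d\times d)$-matrices. The universal pentagram map $T_{\mathcal I,\mathcal J}$ on $d$-tuples of twisted $n$-gons in $\mathbb P^d$ satisfies the duality $$T_{\mathcal I,\mathcal J}^{-1}=T_{-\mathcal J^*,-\mathcal I^*},$$ where $\mathcal I^*$ and $\mathcal J^*$ denote the transposes of the matrices $\mathcal I$ and $\mathcal J$.
   Context: $\mathbb P^d$ is the projective space of dimension $d$ over a field $F$ (e.g. $\mathbb R$, $\mathbb C$ or $\mathbb Q$). A twisted $n$-gon in $\mathbb P^d$ with monodromy $M\in SL_{d+1}(F)$ is a sequence $(v_k)_{k\in\mathbb Z}$ of points of $\mathbb P^d$ with $v_{k+n}=M\circ v_k$ for all $k$, where $M$ acts naturally on $\mathbb P^d$. Universal pentagram map: let $\mathcal I=(i_{\ell,s})_{\ell,s=1}^d$ and $\mathcal J=(j_{p,s})_{p,s=1}^d$ be integer matrices with rows $I_\ell=(i_{\ell,1},\dots,i_{\ell,d})$ (jump tuples) and $J_p=(j_{p,1},\dots,j_{p,d})$ (intersection tuples). Let $(v^1_k),\dots,(v^d_k)$ be $d$ twisted $n$-gons in $\mathbb P^d$ with the same monodromy $M$. For $\ell=1,\dots,d$ and $k\in\mathbb Z$ define the hyperplane $$P^{I_\ell}_k:=(v^1_{k+i_{\ell,1}},v^2_{k+i_{\ell,2}},\dots,v^d_{k+i_{\ell,d}})$$ spanned by the listed $d$ points (one vertex from each polygon). The image of $((v^1_k),\dots,(v^d_k))$ under $T_{\mathcal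 I,\mathcal J}$ is the $d$-tuple of twisted $n$-gons whose $p$-th polygon, $p=1,\dots,d$, has vertices $$T_pv_k:=P^{I_1}_{k+j_{p,1}}\cap P^{I_2}_{k+j_{p,2}}\cap\dots\cap P^{I_d}_{k+j_{p,d}},\qquad k\in\mathbb Z.$$ These maps are generically (partially) defined: they are considered on $d$-tuples of polygons for which every span of $d$ points involved is a hyperplane and every intersection of $d$ hyperplanes involved is a single point. Identities between such maps are understood for those $d$-tuples of polygons for which all hyperplanes and intersection points involved, including those in the construction of the inverse map, are defined in this sense. *)

theory Defs
  imports "HOL-Analysis.Determinants"
begin

text \<open>
  The projective space of the coordinate space \<open>'f ^ 'm\<close> has dimension \<open>CARD('m) - 1\<close>.
  Projective subspaces are represented by the corresponding linear subspaces: points are the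
  linear subspaces of dimension 1, hyperplanes those of codimension 1. The span of a set of points
  is then the linear span of their union, and intersections are set-theoretic.
\<close>

definition proj_points :: "('f::field ^ 'm::finite) set set" where
  "proj_points = {U. vec.subspace U \<and> vec.dim U = 1}"

definition proj_hyperplanes :: "('f::field ^ 'm::finite) set set" where
  "proj_hyperplanes = {H. vec.subspace H \<and> vec.dim H + 1 = CARD('m)}"

definition proj_act :: "'f::field ^ 'm::finite ^ 'm \<Rightarrow> ('f ^ 'm) set \<Rightarrow> ('f ^ 'm) set" where
  "proj_act M U = (\<lambda>x. M *v x) ` U"

definition twisted_polygons ::
    "nat \<Rightarrow> 'f::field ^ 'm::finite ^ 'm \<Rightarrow> (int \<Rightarrow> ('f ^ 'm) set) set" where
  "twisted_polygons n M =
     {v. (\<forall>k. v k \<in> proj_points) \<and> (\<forall>k. v (k + int n) = proj_act M (v k))}"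

text \<open>
  Tuples of polygons are indexed by a finite type \<open>'d\<close>. The entry in row \<open>l\<close> and column \<open>s\<close> of an
  integer matrix \<open>I\<close> is \<open>I $ l $ s\<close>, so that \<open>I $ l\<close> is the jump tuple with index \<open>l\<close>, and
  \<open>J $ p\<close> is the intersection tuple with index \<open>p\<close>.
\<close>

definition polygon_tuples ::
    "nat \<Rightarrow> 'f::field ^ 'm::finite ^ 'm \<Rightarrow> ('d::finite \<Rightarrow> int \<Rightarrow> ('f ^ 'm) set) set" where
  "polygon_tuples n M = {v. \<forall>s. v s \<in> twisted_polygons n M}"

definition jump_plane ::
    "int ^ 'd::finite ^ 'd \<Rightarrow> ('d \<Rightarrow> int \<Rightarrow> ('f::field ^ 'm::finite) set) \<Rightarrow> 'd \<Rightarrow> int \<Rightarrow> ('f ^ 'm) set"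
  where
  "jump_plane I v l k = vec.span (\<Union>s. v s (k + I $ l $ s))"

definition pentagram_map ::
    "int ^ 'd::finite ^ 'd \<Rightarrow> int ^ 'd ^ 'd \<Rightarrow>
     ('d \<Rightarrow> int \<Rightarrow> ('f::field ^ 'm::finite) set) \<Rightarrow> 'd \<Rightarrow> int \<Rightarrow> ('f ^ 'm) set" where
  "pentagram_map I J v p k = (\<Inter>l. jump_plane I v l (k + J $ p $ l))"

text \<open>
  The map is partial. The function above is total only because spans and intersections of linear
  subspaces always exist; the following set is its domain of definition, where every span in the
  construction is a hyperplane and every intersection is a single point.
\<close>

definition pentagram_dom ::
    "nat \<Rightarrow> 'f::field ^ 'm::finite ^ 'm \<Rightarrow> int ^ 'd::finite ^ 'd \<Rightarrow> int ^ 'd ^ 'd \<Rightarrow>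
     ('d \<Rightarrow> int \<Rightarrow> ('f ^ 'm) set) set" where
  "pentagram_dom n M I J =
     {v \<in> polygon_tuples n M.
        (\<forall>l k. jump_plane I v l k \<in> proj_hyperplanes) \<and>
        (\<forall>p k. pentagram_map I J v p k \<in> proj_points)}"

text \<open>
  The domain on which the map for \<open>(I, J)\<close> can be followed by the map for \<open>(I', J')\<close>.
\<close>

definition pentagram_comp_dom ::
    "nat \<Rightarrow> 'f::field ^ 'm::finite ^ 'm \<Rightarrow> int ^ 'd::finite ^ 'd \<Rightarrow> int ^ 'd ^ 'd \<Rightarrow>
     int ^ 'd ^ 'd \<Rightarrow> int ^ 'd ^ 'd \<Rightarrow> ('d \<Rightarrow> int \<Rightarrow> ('f ^ 'm) set) set" where
  "pentagram_comp_dom n M I J I' J' =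
     {v \<in> pentagram_dom n M I J. pentagram_map I J v \<in> pentagram_dom n M I' J'}"

end

theory Submission
  imports Defs
begin

text \<open>
  Put \<open>w = T v\<close>. Each point \<open>w p (k - J p l)\<close> lies on the hyperplane with index \<open>l\<close> of \<open>v\<close> at
  \<open>k\<close>, so the jump planes of \<open>w\<close> for \<open>- transpose J\<close> are contained in the jump planes of \<open>v\<close> for
  \<open>I\<close>, hence equal to them by dimension. All hyperplanes whose intersection is the point with
  index \<open>p\<close> of the second image pass through \<open>v p k\<close>, so that point is \<open>v p k\<close>, again by dimension.
\<close>

lemma proj_points_eqI:
  assumes "U \<in> proj_points" "V \<in> proj_points" "U \<subseteq> V"
  shows "U = V"
  using assms by (intro vec.subspace_dim_equal) (auto simp: proj_points_def)

lemma proj_hyperplanes_eqI: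
  assumes "G \<in> proj_hyperplanes" "H \<in> proj_hyperplanes" "G \<subseteq> H"
  shows "G = H"
  using assms by (intro vec.subspace_dim_equal) (auto simp: proj_hyperplanes_def)

lemma proj_act_span: "proj_act M (vec.span S) = vec.span (proj_act M S)"
  unfolding proj_act_def
  by (rule vec.linear_span_image[OF matrix_vector_mul_linear_gen, symmetric])

lemma proj_act_Union: "proj_act M (\<Union>s. A s) = (\<Union>s. proj_act M (A s))"
  by (auto simp: proj_act_def)

text \<open>Images under a map commute with intersections when the map is injective; this is where
  invertibility of the monodromy enters.\<close>

lemma proj_act_Inter:
  assumes "invertible M"
  shows "proj_act M (\<Inter>s. A s) = (\<Inter>s. proj_act M (A s))"
  unfolding proj_act_def
  using inj_matrix_vector_mult[OF assms] by (intro image_INT[where C = UNIV]) auto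

text \<open>Moves the period to the end of a shifted index, so that the twisting relation applies.
  It is used with \<open>a\<close> fixed to \<open>int n\<close>, which gives the rewriting a
  direction.\<close>

lemma add_right_commute_int: "k + a + b = k + b + (a::int)"
  by simp

lemma jump_plane_shift:
  assumes "v \<in> polygon_tuples n M"
  shows "jump_plane I v l (k + int n) = proj_act M (jump_plane I v l k)"
proof -
  have "v s (k + int n + I $ l $ s) = proj_act M (v s (k + I $ l $ s))" for s
    using assms unfolding polygon_tuples_def twisted_polygons_def
    by (simp add: add_right_commute_int[of k "int n"])
  then show ?thesis
    by (simp add: jump_plane_def proj_act_span proj_act_Union)
qed

lemma pentagram_map_shift:
  assumes "v \<in> polygon_tuples n M" "invertible M"
  shows "pentagram_map I J v p (k + int n) = proj_act M (pentagram_map I J v p k)"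
proof -
  have "jump_plane I v l (k + int n + J $ p $ l) = proj_act M (jump_plane I v l (k + J $ p $ l))" for l
    using jump_plane_shift[OF assms(1)]
    by (simp add: add_right_commute_int[of k "int n"])
  then show ?thesis
    by (simp add: pentagram_map_def proj_act_Inter[OF assms(2)])
qed

lemma pentagram_map_polygon_tuples:
  assumes "v \<in> pentagram_dom n M I J" "invertible M"
  shows "pentagram_map I J v \<in> polygon_tuples n M"
  using assms pentagram_map_shift[of v n M I J]
  by (auto simp: pentagram_dom_def polygon_tuples_def twisted_polygons_def)

lemma subset_jump_plane: "v s (k + I $ l $ s) \<subseteq> jump_plane I v l k"
  unfolding jump_plane_def by (rule order_trans[OF _ vec.span_superset]) auto

lemma jump_plane_pentagram_map_subset:
  assumes "vec.subspace (jump_plane I v l k)"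
  shows "jump_plane (- transpose J) (pentagram_map I J v) l k \<subseteq> jump_plane I v l k"
proof -
  \<comment> \<open>At this index, the factor \<open>l\<close> of the intersection is shifted by
    \<open>J $ s $ l\<close>, which cancels the subtraction and leaves the plane at
    \<open>k\<close>.\<close>
  have "pentagram_map I J v s (k - J $ s $ l) \<subseteq> jump_plane I v l k" for s
    unfolding pentagram_map_def by (rule order_trans[OF INT_lower[of l]]) auto
  then have "(\<Union>s. pentagram_map I J v s (k + (- transpose J) $ l $ s)) \<subseteq> jump_plane I v l k"
    by (auto simp: transpose_def)
  then show ?thesis
    unfolding jump_plane_def[of "- transpose J"] by (rule vec.span_minimal) (rule assms)
qed

lemma pentagram_map_left_inverse:
  assumes "v \<in> pentagram_comp_dom n M I J (- transpose J) (- transpose I)"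
  shows "pentagram_map (- transpose J) (- transpose I) (pentagram_map I J v) = v"
proof (intro ext)
  fix p k
  let ?w = "pentagram_map I J v"
  have v: "v p k \<in> proj_points" "\<And>l k. jump_plane I v l k \<in> proj_hyperplanes"
    and w: "\<And>l k. jump_plane (- transpose J) ?w l k \<in> proj_hyperplanes"
      "pentagram_map (- transpose J) (- transpose I) ?w p k \<in> proj_points"
    using assms
    by (auto simp: pentagram_comp_dom_def pentagram_dom_def polygon_tuples_def twisted_polygons_def)
  have plane: "jump_plane (- transpose J) ?w l k = jump_plane I v l k" for l k
    by (rule proj_hyperplanes_eqI[OF w(1) v(2)], rule jump_plane_pentagram_map_subset)
      (simp add: jump_plane_def)
  \<comment> \<open>The shifts \<open>- I $ l $ p\<close> are the entries of row \<open>p\<close> of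
    \<open>- transpose I\<close>, so these planes are exactly the ones that the second map
    intersects.\<close>
  have "v p k \<subseteq> jump_plane I v l (k - I $ l $ p)" for l
    using subset_jump_plane[of v p "k - I $ l $ p" I l] by simp
  then have "v p k \<subseteq> pentagram_map (- transpose J) (- transpose I) ?w p k"
    unfolding pentagram_map_def[of "- transpose J"] plane by (auto simp: transpose_def)
  then show "pentagram_map (- transpose J) (- transpose I) ?w p k = v p k"
    using proj_points_eqI[OF v(1) w(2)] by simp
qed

text \<open>Following the image by the second map leads back to \<open>v\<close>, which lies in the
  domain of the first map by assumption.\<close>

lemma pentagram_map_comp_dom:
  assumes "v \<in> pentagram_comp_dom n M I J (- transpose J) (- transpose I)"
  shows "pentagram_map I J v \<in> pentagram_comp_dom n M (- transpose J) (- transpose I) I J"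
  using assms pentagram_map_left_inverse[OF assms] by (simp add: pentagram_comp_dom_def)

theorem theorem4p4:
  fixes I J :: "int ^ 'd::finite ^ 'd"
    and M :: "'f::field ^ 'm::finite ^ 'm"
    and n :: nat
  assumes "CARD('d) \<ge> 2"
    and "CARD('m) = CARD('d) + 1"
    and "det M = 1"
  defines "T \<equiv> pentagram_map I J :: ('d \<Rightarrow> int \<Rightarrow> ('f ^ 'm) set) \<Rightarrow> _"
    and "T' \<equiv> pentagram_map (- transpose J) (- transpose I) :: ('d \<Rightarrow> int \<Rightarrow> ('f ^ 'm) set) \<Rightarrow> _"
    and "U \<equiv> pentagram_comp_dom n M I J (- transpose J) (- transpose I)"
    and "U' \<equiv> pentagram_comp_dom n M (- transpose J) (- transpose I) I J"
  shows "(\<forall>v \<in> pentagram_dom n M I J. T v \<in> polygon_tuples n M) \<and>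
         bij_betw T U U' \<and>
         (\<forall>v \<in> U. T' (T v) = v) \<and>
         (\<forall>w \<in> U'. T (T' w) = w)"
proof -
  \<comment> \<open>Negated transposition is an involution, so the right inverse is the left inverse
    for the pair \<open>- transpose J\<close>, \<open>- transpose I\<close>.\<close>
  have neg: "- transpose (- transpose A) = A" for A :: "int ^ 'd ^ 'd"
    by (simp add: transpose_def vec_eq_iff)
  have inv: "invertible M"
    using assms(3) by (simp add: invertible_det_nz)
  have left: "\<forall>v \<in> U. T' (T v) = v" and U: "T ` U \<subseteq> U'"
    unfolding T_def T'_def U_def U'_def
    using pentagram_map_left_inverse pentagram_map_comp_dom by blast+
  have right: "\<forall>w \<in> U'. T (T' w) = w" and U': "T' ` U' \<subseteq> U"
    unfolding T_def T'_def U_def U'_def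
    using pentagram_map_left_inverse[of _ n M "- transpose J" "- transpose I"]
      pentagram_map_comp_dom[of _ n M "- transpose J" "- transpose I"]
    by (auto simp: neg)
  have "bij_betw T U U'"
    using left right U U' by (rule bij_betw_byWitness)
  with left right show ?thesis
    using pentagram_map_polygon_tuples[OF _ inv] by (auto simp: T_def)
qed

end
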